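(* Let $A=(A,\cdot,\circ)$ be a finite skew brace such that $(A,\cdot)\simeq C_p^n$ for some prime $p$ and some $n\in\mathbb{N}$. Then $A$ is left-simple if and only if $n=1$.
   Context: A skew brace is a set $A=(A,\cdot,\circ)$ equipped with two group operations $\cdot$ and $\circ$ such that $a\circ(b\cdot c)=(a\circ b)\cdot a^{-1}\cdot(a\circ c)$ for all $a,b,c\in A$, where $a^{-1}$ denotes the inverse of $a$ in $(A,\cdot)$. The two groups share the same identity $1$. The group $(A,\cdot)$ is called the additive group of $A$. For $a\in A$, the map $\lambda_a:A\to A$, $\lambda_a(x)=a^{-1}\cdot(a\circ x)$, is an automorphism of $(A,\cdot)$. A left ideal of $A$ is a subgroup $I$ of $(A,\cdot)$ such that $\lambda_a(I)\subseteq I$ for all $a\in A$. A skew brace $A$ is left-simple if $A\neq 1$ and $A$ has no left ideal other than $1$ and $A$. Here $C_p$ denotes the cyclic group of order $p$, $C_p^n$ is the direct product of $n$ copies of it, and $\mathbb{N}$ denotes the positive integers. *)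

theory Defs
  imports "HOL-Algebra.Algebra"
begin

text \<open>
  A skew brace \<open>(A, \<cdot>, \<circ>)\<close> is represented by two group structures \<open>G = (A, \<cdot>)\<close> (the additive group)
  and \<open>H = (A, \<circ>)\<close> on one carrier. That their identities agree is not assumed; it is derived in
  \<open>skew_brace.one_eq\<close>.
\<close>

locale skew_brace = G: group G + H: group H
  for G :: "('a, 'b) monoid_scheme" and H :: "('a, 'c) monoid_scheme" +
  assumes carrier_eq: "carrier H = carrier G"
    and brace_relation:
      "\<lbrakk>a \<in> carrier G; b \<in> carrier G; c \<in> carrier G\<rbrakk>
        \<Longrightarrow> a \<otimes>\<^bsub>H\<^esub> (b \<otimes>\<^bsub>G\<^esub> c) = (a \<otimes>\<^bsub>H\<^esub> b) \<otimes>\<^bsub>G\<^esub> inv\<^bsub>G\<^esub> a \<otimes>\<^bsub>G\<^esub> (a \<otimes>\<^bsub>H\<^esub> c)"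

definition brace_lambda ::
    "('a, 'b) monoid_scheme \<Rightarrow> ('a, 'c) monoid_scheme \<Rightarrow> 'a \<Rightarrow> 'a \<Rightarrow> 'a" where
  "brace_lambda G H a x = inv\<^bsub>G\<^esub> a \<otimes>\<^bsub>G\<^esub> (a \<otimes>\<^bsub>H\<^esub> x)"

definition left_ideal ::
    "('a, 'b) monoid_scheme \<Rightarrow> ('a, 'c) monoid_scheme \<Rightarrow> 'a set \<Rightarrow> bool" where
  "left_ideal G H I \<longleftrightarrow> subgroup I G \<and> (\<forall>a\<in>carrier G. brace_lambda G H a ` I \<subseteq> I)"

definition left_simple ::
    "('a, 'b) monoid_scheme \<Rightarrow> ('a, 'c) monoid_scheme \<Rightarrow> bool" where
  "left_simple G H \<longleftrightarrow> carrier G \<noteq> {\<one>\<^bsub>G\<^esub>} \<and>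
     (\<forall>I. left_ideal G H I \<longrightarrow> I = {\<one>\<^bsub>G\<^esub>} \<or> I = carrier G)"

definition cyclic_power :: "nat \<Rightarrow> nat \<Rightarrow> (nat \<Rightarrow> int) monoid" where
  "cyclic_power p n = product_group {..<n} (\<lambda>_. integer_mod_group p)"

context skew_brace
begin

lemma circ_closed: "a \<in> carrier G \<Longrightarrow> b \<in> carrier G \<Longrightarrow> a \<otimes>\<^bsub>H\<^esub> b \<in> carrier G"
  using H.m_closed carrier_eq by auto

lemma one_eq: "\<one>\<^bsub>H\<^esub> = \<one>\<^bsub>G\<^esub>"
proof -
  have h: "\<one>\<^bsub>H\<^esub> \<in> carrier G" using H.one_closed carrier_eq by auto
  have l: "\<one>\<^bsub>H\<^esub> \<otimes>\<^bsub>H\<^esub> \<one>\<^bsub>G\<^esub> = \<one>\<^bsub>G\<^esub>" using carrier_eq by (simp add: H.l_one)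
  have "\<one>\<^bsub>H\<^esub> \<otimes>\<^bsub>H\<^esub> (\<one>\<^bsub>G\<^esub> \<otimes>\<^bsub>G\<^esub> \<one>\<^bsub>G\<^esub>)
      = (\<one>\<^bsub>H\<^esub> \<otimes>\<^bsub>H\<^esub> \<one>\<^bsub>G\<^esub>) \<otimes>\<^bsub>G\<^esub> inv\<^bsub>G\<^esub> \<one>\<^bsub>H\<^esub> \<otimes>\<^bsub>G\<^esub> (\<one>\<^bsub>H\<^esub> \<otimes>\<^bsub>H\<^esub> \<one>\<^bsub>G\<^esub>)"
    using h by (intro brace_relation) auto
  then have "inv\<^bsub>G\<^esub> \<one>\<^bsub>H\<^esub> = \<one>\<^bsub>G\<^esub>" using h l by simp
  then show ?thesis using h by (metis G.inv_inv G.inv_one)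
qed

lemma brace_lambda_hom:
  assumes "a \<in> carrier G"
  shows "brace_lambda G H a \<in> hom G G"
  using assms
  by (auto simp: hom_def brace_lambda_def circ_closed brace_relation G.m_assoc)

end

end

theory Submission
  imports Defs "HOL-Number_Theory.Cong"
begin

text \<open>
  The maps \<open>\<lambda>\<^sub>a\<close> form an action of the multiplicative group \<open>(A, \<circ>)\<close> on the additive group by
  automorphisms (\<open>brace_lambda_action\<close>, \<open>brace_lambda_hom\<close>). Both groups live on the same set, so here
  \<open>(A, \<circ>)\<close> has order \<open>p\<^sup>n\<close>: a \<open>p\<close>-group acts on a set whose size is divisible by \<open>p\<close>. All orbits other
  than the fixed points have size divisible by \<open>p\<close>, so the number of fixed points is divisible by \<open>p\<close>
  as well (\<open>card_fixed_points_cong\<close>). As \<open>1\<close> is fixed, there is a fixed point \<open>x \<noteq> 1\<close>.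

  An automorphism that fixes \<open>x\<close> fixes every power of \<open>x\<close>, so the additive subgroup generated by \<open>x\<close> is
  a left ideal (\<open>left_ideal_generate_fixed\<close>); it has order at most \<open>p\<close> because the additive group
  has exponent \<open>p\<close>. If \<open>A\<close> is left-simple, this left ideal is all of \<open>A\<close>, whence \<open>p\<^sup>n \<le> p\<close> and \<open>n = 1\<close>.
  Conversely, a group of prime order has no proper nontrivial subgroup at all, by Lagrange.
\<close>


text \<open>
  The orbits of size one are exactly the singletons of fixed points; every other orbit size
  divides the order \<open>p\<^sup>k\<close> of the group and is not \<open>1\<close>, so \<open>p\<close> divides it.
\<close>

lemma (in group_action) card_fixed_points_cong:
  assumes p: "Factorial_Ring.prime p" and order: "order G = p ^ k" and fin: "finite E"
  shows "[card E = card {x \<in> E. \<forall>g\<in>carrier G. \<phi> g x = x}] (mod p)"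
proof -
  interpret group G
    using group_hom group_hom.axioms(1) by auto
  let ?F = "{x \<in> E. \<forall>g\<in>carrier G. \<phi> g x = x}"
  let ?C = "{B \<in> orbits G E \<phi>. card B \<noteq> 1}"
  have orbit_card_1: "card (orbit G \<phi> x) = 1 \<longleftrightarrow> x \<in> ?F" if x: "x \<in> E" for x
  proof
    assume "card (orbit G \<phi> x) = 1"
    then have "orbit G \<phi> x = {x}"
      using orbit_refl[OF x] by (metis card_1_singletonE singletonD)
    then show "x \<in> ?F"
      using x by (auto simp: orbit_def)
  next
    assume "x \<in> ?F"
    then have "orbit G \<phi> x = {x}"
      using orbit_refl[OF x] by (auto simp: orbit_def)
    then show "card (orbit G \<phi> x) = 1"
      by simp
  qed
  have orbit_eq: "B = orbit G \<phi> x" if "B \<in> orbits G E \<phi>" "x \<in> B" "x \<in> E" for B x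
    using that disjoint_union[of B "orbit G \<phi> x"] orbit_refl[of x] by (auto simp: orbits_def)
  have Union_C: "\<Union>?C = E - ?F"
  proof (intro equalityI subsetI)
    fix x assume "x \<in> \<Union>?C"
    then obtain B where B: "B \<in> orbits G E \<phi>" "card B \<noteq> 1" "x \<in> B"
      by blast
    then have "x \<in> E"
      using orbits_coverture by blast
    then show "x \<in> E - ?F"
      using B orbit_eq orbit_card_1 by blast
  next
    fix x assume "x \<in> E - ?F"
    then have "x \<in> orbit G \<phi> x" "orbit G \<phi> x \<in> ?C"
      using orbit_refl orbit_card_1 by (auto simp: orbits_def)
    then show "x \<in> \<Union>?C"
      by blast
  qed
  have C_dvd: "\<forall>B\<in>?C. p dvd card B"
  proof
    fix B assume B: "B \<in> ?C"
    then obtain x where x: "x \<in> E" "B = orbit G \<phi> x"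
      by (auto simp: orbits_def)
    have "card B dvd p ^ k"
      using orbit_stabilizer_theorem[OF x(1)] order x(2) by (metis dvd_triv_left)
    then obtain j where "card B = p ^ j"
      using divides_primepow_nat[OF p] by blast
    with B show "p dvd card B"
      by (cases j) auto
  qed
  have "\<forall>B\<in>?C. \<forall>B'\<in>?C. B \<noteq> B' \<longrightarrow> B \<inter> B' = {}"
    using disjoint_union by blast
  then have "p dvd card (E - ?F)"
    using dvd_partition[of ?C p] C_dvd fin unfolding Union_C by blast
  moreover have "card E = card ?F + card (E - ?F)"
    using fin by (simp add: card_Diff_subset card_mono)
  ultimately show ?thesis
    by (auto simp: cong_def elim!: dvdE)
qed

context skew_brace
begin

lemma circ_eq_mult_lambda:
  assumes "a \<in> carrier G" "x \<in> carrier G"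
  shows "a \<otimes>\<^bsub>H\<^esub> x = a \<otimes>\<^bsub>G\<^esub> brace_lambda G H a x"
  using assms by (simp add: brace_lambda_def circ_closed flip: G.m_assoc)

lemma brace_lambda_closed:
  assumes "a \<in> carrier G" "x \<in> carrier G"
  shows "brace_lambda G H a x \<in> carrier G"
  using assms by (simp add: brace_lambda_def circ_closed)

text \<open>
  Both sides agree after multiplication by \<open>a \<circ> b\<close> on the left: this is associativity of \<open>\<circ>\<close>, written
  out with \<open>a \<circ> y = a \<cdot> \<lambda>\<^sub>a(y)\<close> and with \<open>\<lambda>\<^sub>a\<close> additive.
\<close>

lemma brace_lambda_circ:
  assumes a: "a \<in> carrier G" and b: "b \<in> carrier G" and x: "x \<in> carrier G"
  shows "brace_lambda G H (a \<otimes>\<^bsub>H\<^esub> b) x = brace_lambda G H a (brace_lambda G H b x)"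
    (is "?l = ?r")
proof -
  have "(a \<otimes>\<^bsub>H\<^esub> b) \<otimes>\<^bsub>G\<^esub> ?l = (a \<otimes>\<^bsub>H\<^esub> b) \<otimes>\<^bsub>H\<^esub> x"
    using circ_eq_mult_lambda[OF circ_closed[OF a b] x] by (rule sym)
  also have "\<dots> = a \<otimes>\<^bsub>H\<^esub> (b \<otimes>\<^bsub>H\<^esub> x)"
    using a b x by (intro H.m_assoc) (simp_all add: carrier_eq)
  also have "\<dots> = a \<otimes>\<^bsub>G\<^esub> brace_lambda G H a (b \<otimes>\<^bsub>G\<^esub> brace_lambda G H b x)"
    using a b x by (simp add: circ_eq_mult_lambda brace_lambda_closed)
  also have "\<dots> = (a \<otimes>\<^bsub>H\<^esub> b) \<otimes>\<^bsub>G\<^esub> ?r"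
    using a b x hom_mult[OF brace_lambda_hom[OF a]]
    by (simp add: circ_eq_mult_lambda brace_lambda_closed G.m_assoc)
  finally show ?thesis
    using a b x by (simp add: circ_closed brace_lambda_closed)
qed

lemma brace_lambda_one:
  assumes "x \<in> carrier G"
  shows "brace_lambda G H \<one>\<^bsub>H\<^esub> x = x"
proof -
  have "\<one>\<^bsub>H\<^esub> \<otimes>\<^bsub>H\<^esub> x = x"
    using assms by (intro H.l_one) (simp add: carrier_eq)
  then show ?thesis
    using assms by (simp add: brace_lambda_def one_eq)
qed

text \<open>
  The restriction to the carrier only serves \<open>Bij\<close>, whose members are \<open>undefined\<close> outside their domain.
\<close>

lemma brace_lambda_action:
  "group_action H (carrier G) (\<lambda>a. restrict (brace_lambda G H a) (carrier G))"
proof -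
  let ?\<phi> = "\<lambda>a. restrict (brace_lambda G H a) (carrier G)"
  have Bij: "?\<phi> a \<in> Bij (carrier G)" if a: "a \<in> carrier G" for a
  proof -
    have aH: "a \<in> carrier H" and inv: "inv\<^bsub>H\<^esub> a \<in> carrier G"
      using a carrier_eq H.inv_closed by auto
    have "brace_lambda G H (inv\<^bsub>H\<^esub> a) (brace_lambda G H a x) = x"
      "brace_lambda G H a (brace_lambda G H (inv\<^bsub>H\<^esub> a) x) = x" if "x \<in> carrier G" for x
      using brace_lambda_circ[OF inv a that] brace_lambda_circ[OF a inv that]
        brace_lambda_one[OF that] H.l_inv[OF aH] H.r_inv[OF aH] by simp_all
    then have "bij_betw (brace_lambda G H a) (carrier G) (carrier G)"
      using a inv
      by (intro bij_betw_byWitness[where f' = "brace_lambda G H (inv\<^bsub>H\<^esub> a)"])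
        (auto simp: brace_lambda_closed)
    then show ?thesis
      by (simp add: Bij_def)
  qed
  have "?\<phi> \<in> hom H (BijGroup (carrier G))"
  proof (rule homI)
    fix a assume "a \<in> carrier H"
    then show "?\<phi> a \<in> carrier (BijGroup (carrier G))"
      using Bij by (simp add: BijGroup_def carrier_eq)
  next
    fix a b assume "a \<in> carrier H" "b \<in> carrier H"
    then have ab: "a \<in> carrier G" "b \<in> carrier G"
      by (simp_all add: carrier_eq)
    show "?\<phi> (a \<otimes>\<^bsub>H\<^esub> b) = ?\<phi> a \<otimes>\<^bsub>BijGroup (carrier G)\<^esub> ?\<phi> b"
      using Bij[OF ab(1)] Bij[OF ab(2)] ab
      by (simp add: BijGroup_def compose_def brace_lambda_circ brace_lambda_closed
          cong: restrict_cong)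
  qed
  then show ?thesis
    by (simp add: group_action_def group_hom_def group_hom_axioms_def group_BijGroup H.is_group)
qed

text \<open>
  A homomorphism maps the subgroup generated by a set onto the one generated by the image of the
  set, and \<open>{x}\<close> is its own image.
\<close>

lemma left_ideal_generate_fixed:
  assumes x: "x \<in> carrier G" and fixed: "\<And>a. a \<in> carrier G \<Longrightarrow> brace_lambda G H a x = x"
  shows "left_ideal G H (generate G {x})"
  unfolding left_ideal_def
proof (intro conjI ballI)
  show "subgroup (generate G {x}) G"
    using x by (simp add: G.generate_is_subgroup)
next
  fix a assume a: "a \<in> carrier G"
  then interpret lam: group_hom G G "brace_lambda G H a"
    using brace_lambda_hom by unfold_locales auto
  show "brace_lambda G H a ` generate G {x} \<subseteq> generate G {x}"
    using lam.generate_img[of "{x}"] x fixed[OF a] by simp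
qed

end

lemma order_cyclic_power:
  assumes "p > 0"
  shows "order (cyclic_power p n) = p ^ n"
  using assms by (simp add: order_def cyclic_power_def card_PiE carrier_integer_mod_group)

lemma pow_cyclic_power:
  assumes "x \<in> carrier (cyclic_power p n)"
  shows "x [^]\<^bsub>cyclic_power p n\<^esub> p = \<one>\<^bsub>cyclic_power p n\<^esub>"
proof -
  have "x [^]\<^bsub>cyclic_power p n\<^esub> k = (\<lambda>i\<in>{..<n}. x i [^]\<^bsub>integer_mod_group p\<^esub> k)" for k :: nat
    by (induction k) (auto simp: cyclic_power_def intro!: restrict_ext)
  then show ?thesis
    by (simp add: cyclic_power_def)
qed

lemma (in group) ord_dvd_iso_cyclic_power:
  assumes "G \<cong> cyclic_power p n" "x \<in> carrier G"
  shows "ord x dvd p"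
proof -
  obtain f where f: "f \<in> iso G (cyclic_power p n)"
    using assms(1) by (auto simp: is_iso_def)
  interpret C: group "cyclic_power p n"
    by (simp add: cyclic_power_def)
  interpret f: group_hom G "cyclic_power p n" f
    using f by unfold_locales (auto simp: iso_def)
  have "f (x [^] p) = f \<one>"
    using assms(2) by (simp add: f.hom_nat_pow pow_cyclic_power)
  then have "x [^] p = \<one>"
    using f assms(2) by (auto simp: iso_def bij_betw_def inj_on_def)
  then show ?thesis
    using assms(2) by (simp add: pow_eq_id)
qed

theorem theorem1p2:
  fixes G :: "('a, 'b) monoid_scheme" and H :: "('a, 'c) monoid_scheme"
    and p n :: nat
  assumes "skew_brace G H"
    and "finite (carrier G)"
    and "Factorial_Ring.prime p"
    and "n \<ge> 1"
    and "G \<cong> cyclic_power p n"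
  shows "left_simple G H \<longleftrightarrow> n = 1"
proof -
  interpret skew_brace G H
    by fact
  note fin = assms(2) and p = assms(3)
  have card: "card (carrier G) = p ^ n"
    using iso_same_card[OF assms(5)] order_cyclic_power[of p n] prime_gt_0_nat[OF p]
    by (simp add: order_def)
  show ?thesis
  proof
    assume simple: "left_simple G H"
    interpret act: group_action H "carrier G" "\<lambda>a. restrict (brace_lambda G H a) (carrier G)"
      by (rule brace_lambda_action)
    define F where "F = {x \<in> carrier G. \<forall>a\<in>carrier G. brace_lambda G H a x = x}"
    have "{x \<in> carrier G. \<forall>a\<in>carrier H. restrict (brace_lambda G H a) (carrier G) x = x} = F"
      by (auto simp: F_def carrier_eq)
    then have "[card (carrier G) = card F] (mod p)"
      using act.card_fixed_points_cong[OF p, of n] card fin by (simp add: order_def carrier_eq)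
    moreover have "p dvd card (carrier G)"
      using card assms(4) by simp
    ultimately have "p dvd card F"
      using cong_dvd_iff by blast
    then have "card F \<noteq> 1"
      using p by (auto simp: prime_nat_iff)
    then have "F \<noteq> {\<one>\<^bsub>G\<^esub>}"
      by auto
    moreover have "\<one>\<^bsub>G\<^esub> \<in> F"
      using hom_one[OF brace_lambda_hom G.is_group G.is_group] by (auto simp: F_def)
    ultimately obtain x where x: "x \<in> F" "x \<noteq> \<one>\<^bsub>G\<^esub>"
      by blast
    then have xG: "x \<in> carrier G"
      by (simp add: F_def)
    have "left_ideal G H (generate G {x})"
      using x by (intro left_ideal_generate_fixed) (auto simp: F_def)
    moreover have "generate G {x} \<noteq> {\<one>\<^bsub>G\<^esub>}"
      using x generate.incl[of x "{x}" G] by blast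
    ultimately have "generate G {x} = carrier G"
      using simple by (auto simp: left_simple_def)
    then have "p ^ n dvd p ^ 1"
      using G.generate_pow_card[OF xG] G.ord_dvd_iso_cyclic_power[OF assms(5) xG] card by simp
    then show "n = 1"
      using assms(4) prime_gt_1_nat[OF p] by (simp add: power_dvd_imp_le le_antisym)
  next
    assume n: "n = 1"
    have "I = {\<one>\<^bsub>G\<^esub>} \<or> I = carrier G" if "left_ideal G H I" for I
    proof -
      have I: "subgroup I G"
        using that by (simp add: left_ideal_def)
      have "card I dvd p"
        using G.lagrange[OF I] card n by (metis dvd_triv_right order_def power_one_right)
      then consider "card I = 1" | "card I = card (carrier G)"
        using p card n by (auto simp: prime_nat_iff)
      then show ?thesis
      proof cases
        case 1
        then show ?thesis
          using subgroup.one_closed[OF I] by (auto simp: card_1_singleton_iff)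
      next
        case 2
        then show ?thesis
          using card_subset_eq[OF fin subgroup.subset[OF I]] by simp
      qed
    qed
    moreover have "carrier G \<noteq> {\<one>\<^bsub>G\<^esub>}"
      using card n p by auto
    ultimately show "left_simple G H"
      by (simp add: left_simple_def)
  qed
qed

end
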